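(* $\mathcal{WN}_{\beta\mu\mu'\rho\varepsilon}\subseteq\mathcal{WN}_{\beta\mu\mu'\rho\varepsilon\theta}$.
   Context: $\lambda\mu$-terms: $\mathcal{T} ::= x \mid \lambda x.\mathcal{T} \mid (\mathcal{T})\mathcal{T} \mid [\alpha]\mathcal{T} \mid \mu\alpha.\mathcal{T}$ ($x$ $\lambda$-variables, $\alpha$ $\mu$-variables), up to renaming of bound variables; substitutions avoid capture. $M[x:=N]$ usual substitution; $M[\alpha:=\beta]$ renames free $\alpha$ to $\beta$; $M[\alpha:=_rN]$ (resp. $M[\alpha:=_lN]$) replaces inductively every subterm $[\alpha]P$ by $[\alpha](P')N$ (resp. $[\alpha](N)P'$), $P'$ the substituted $P$; $M_\alpha$ replaces inductively every subterm $[\alpha]P$ by $P$. Rules: $\beta$: $(\lambda x.M)N\to M[x:=N]$; $\mu$: $(\mu\alpha.M)N\to\mu\alpha.M[\alpha:=_rN]$; $\mu'$: $(N)\mu\alpha.M\to\mu\alpha.M[\alpha:=_lN]$; $\rho$: $[\beta]\mu\alpha.M\to M[\alpha:=\beta]$; $\theta$: $\mu\alpha.[\alpha]M\to M$ if $\alpha\notin\mathrm{fv}(M)$; $\varepsilon$: $\mu\alpha.\mu\beta.M\to\mu\alpha.M_\beta$. For a set $\mathcal{R}$ of rules, a one-step $\mathcal{R}$-reduction contracts one $\mathcal{R}$-redex anywhere in a term; $\mathcal{WN}_{\mathcal{R}}$ is the set of (untyped) terms that reduce in finitely many $\mathcal{R}$-steps to a term containing no $\mathcal{R}$-redex. *)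

theory Defs
  imports Main
begin

text \<open>
  \<open>\<lambda>\<mu>\<close>-terms up to renaming of bound variables, with de Bruijn indices: \<open>\<lambda>\<close>- and \<open>\<mu>\<close>-variables are
  counted separately, \<open>Lam\<close> binding \<open>\<lambda>\<close>-index 0 and \<open>Mu\<close> binding \<open>\<mu>\<close>-index 0 of its body.
  \<open>Named a M\<close> is \<open>[a]M\<close>; it is a term like any other and binds nothing.
\<close>

datatype trm =
    Var nat
  | Lam trm
  | App trm trm
  | Named nat trm
  | Mu trm

primrec up :: "(nat \<Rightarrow> nat) \<Rightarrow> nat \<Rightarrow> nat" where
  "up f 0 = 0"
| "up f (Suc i) = Suc (f i)"

text \<open>Renaming of the free \<open>\<lambda>\<close>-variables, resp. \<open>\<mu>\<close>-variables.\<close>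

primrec ren_lam :: "(nat \<Rightarrow> nat) \<Rightarrow> trm \<Rightarrow> trm" where
  "ren_lam f (Var i) = Var (f i)"
| "ren_lam f (Lam M) = Lam (ren_lam (up f) M)"
| "ren_lam f (App M N) = App (ren_lam f M) (ren_lam f N)"
| "ren_lam f (Named a M) = Named a (ren_lam f M)"
| "ren_lam f (Mu M) = Mu (ren_lam f M)"

primrec ren_mu :: "(nat \<Rightarrow> nat) \<Rightarrow> trm \<Rightarrow> trm" where
  "ren_mu f (Var i) = Var i"
| "ren_mu f (Lam M) = Lam (ren_mu f M)"
| "ren_mu f (App M N) = App (ren_mu f M) (ren_mu f N)"
| "ren_mu f (Named a M) = Named (f a) (ren_mu f M)"
| "ren_mu f (Mu M) = Mu (ren_mu (up f) M)"

text \<open>\<open>ren_lam Suc\<close> and \<open>ren_mu Suc\<close> move a term under one more binder;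
  \<open>drop_mu\<close> undoes \<open>ren_mu Suc\<close>: it removes an enclosing \<open>Mu\<close> whose variable does not occur in \<open>M\<close>.\<close>

definition drop_mu :: "trm \<Rightarrow> trm" where
  "drop_mu M = ren_mu (\<lambda>i. i - 1) M"

primrec fv_mu :: "trm \<Rightarrow> nat set" where
  "fv_mu (Var i) = {}"
| "fv_mu (Lam M) = fv_mu M"
| "fv_mu (App M N) = fv_mu M \<union> fv_mu N"
| "fv_mu (Named a M) = insert a (fv_mu M)"
| "fv_mu (Mu M) = {a. Suc a \<in> fv_mu M}"

text \<open>\<open>subst k N M\<close> is \<open>M[k := N]\<close> together with the removal of the binder of \<open>k\<close>:
  the indices above \<open>k\<close> decrease.\<close>

primrec subst :: "nat \<Rightarrow> trm \<Rightarrow> trm \<Rightarrow> trm" where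
  "subst k N (Var i) = (if i = k then N else if k < i then Var (i - 1) else Var i)"
| "subst k N (Lam M) = Lam (subst (Suc k) (ren_lam Suc N) M)"
| "subst k N (App M M') = App (subst k N M) (subst k N M')"
| "subst k N (Named a M) = Named a (subst k N M)"
| "subst k N (Mu M) = Mu (subst k (ren_mu Suc N) M)"

text \<open>\<open>subst_r a N M\<close> is \<open>M[a :=\<^sub>r N]\<close> and \<open>subst_l a N M\<close> is \<open>M[a :=\<^sub>l N]\<close>;
  \<open>a\<close> remains a variable, so no index decreases.\<close>

primrec subst_r :: "nat \<Rightarrow> trm \<Rightarrow> trm \<Rightarrow> trm" where
  "subst_r a N (Var i) = Var i"
| "subst_r a N (Lam M) = Lam (subst_r a (ren_lam Suc N) M)"
| "subst_r a N (App M M') = App (subst_r a N M) (subst_r a N M')"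
| "subst_r a N (Named b P) =
     Named b (if b = a then App (subst_r a N P) N else subst_r a N P)"
| "subst_r a N (Mu M) = Mu (subst_r (Suc a) (ren_mu Suc N) M)"

primrec subst_l :: "nat \<Rightarrow> trm \<Rightarrow> trm \<Rightarrow> trm" where
  "subst_l a N (Var i) = Var i"
| "subst_l a N (Lam M) = Lam (subst_l a (ren_lam Suc N) M)"
| "subst_l a N (App M M') = App (subst_l a N M) (subst_l a N M')"
| "subst_l a N (Named b P) =
     Named b (if b = a then App N (subst_l a N P) else subst_l a N P)"
| "subst_l a N (Mu M) = Mu (subst_l (Suc a) (ren_mu Suc N) M)"

text \<open>\<open>erase a M\<close> is \<open>M\<^sub>a\<close>.\<close>

primrec erase :: "nat \<Rightarrow> trm \<Rightarrow> trm" where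
  "erase a (Var i) = Var i"
| "erase a (Lam M) = Lam (erase a M)"
| "erase a (App M N) = App (erase a M) (erase a N)"
| "erase a (Named b P) = (if b = a then erase a P else Named b (erase a P))"
| "erase a (Mu M) = Mu (erase (Suc a) M)"

datatype rule = \<beta> | \<mu> | \<mu>' | \<rho> | \<theta> | \<epsilon>

text \<open>In \<open>\<rho>\<close>, \<open>case_nat b (\<lambda>i. i)\<close> sends the variable bound by the removed \<open>Mu\<close> to \<open>b\<close> and lowers the
  others. In \<open>\<epsilon>\<close>, index 0 of \<open>M\<close> belongs to the inner \<open>Mu\<close>, the one that is removed.\<close>

inductive contracts :: "rule \<Rightarrow> trm \<Rightarrow> trm \<Rightarrow> bool" where
  "contracts \<beta> (App (Lam M) N) (subst 0 N M)"
| "contracts \<mu> (App (Mu M) N) (Mu (subst_r 0 (ren_mu Suc N) M))"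
| "contracts \<mu>' (App N (Mu M)) (Mu (subst_l 0 (ren_mu Suc N) M))"
| "contracts \<rho> (Named b (Mu M)) (ren_mu (case_nat b (\<lambda>i. i)) M)"
| "0 \<notin> fv_mu M \<Longrightarrow> contracts \<theta> (Mu (Named 0 M)) (drop_mu M)"
| "contracts \<epsilon> (Mu (Mu M)) (Mu (drop_mu (erase 0 M)))"

inductive step :: "rule set \<Rightarrow> trm \<Rightarrow> trm \<Rightarrow> bool" for R where
  "r \<in> R \<Longrightarrow> contracts r M N \<Longrightarrow> step R M N"
| "step R M M' \<Longrightarrow> step R (Lam M) (Lam M')"
| "step R M M' \<Longrightarrow> step R (App M N) (App M' N)"
| "step R N N' \<Longrightarrow> step R (App M N) (App M N')"
| "step R M M' \<Longrightarrow> step R (Named a M) (Named a M')"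
| "step R M M' \<Longrightarrow> step R (Mu M) (Mu M')"

primrec subterms :: "trm \<Rightarrow> trm set" where
  "subterms (Var i) = {Var i}"
| "subterms (Lam M) = insert (Lam M) (subterms M)"
| "subterms (App M N) = insert (App M N) (subterms M \<union> subterms N)"
| "subterms (Named a M) = insert (Named a M) (subterms M)"
| "subterms (Mu M) = insert (Mu M) (subterms M)"

definition redex :: "rule set \<Rightarrow> trm \<Rightarrow> bool" where
  "redex R M \<longleftrightarrow> (\<exists>r\<in>R. \<exists>N. contracts r M N)"

definition normal :: "rule set \<Rightarrow> trm \<Rightarrow> bool" where
  "normal R M \<longleftrightarrow> (\<forall>P\<in>subterms M. \<not> redex R P)"

definition WN :: "rule set \<Rightarrow> trm set" where
  "WN R = {M. \<exists>N. (step R)\<^sup>*\<^sup>* M N \<and> normal R N}"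

end

theory Submission
  imports Defs
begin

text \<open>
  In a normal form for the rules other than \<open>\<theta>\<close>, a subterm \<open>\<mu>\<alpha>.M\<close> can only stand at the root or
  directly under a \<open>\<lambda>\<close>: in any other position it is part of a redex. Contracting a \<open>\<theta>\<close>-redex
  at such a place creates no redex, whatever the shape of the contractum. So \<open>\<theta>\<close>-steps preserve
  these normal forms, and since they decrease the size, they end in a term that is normal for
  all the rules.
\<close>

abbreviation base_rules :: "rule set" where
  "base_rules \<equiv> {\<beta>, \<mu>, \<mu>', \<rho>, \<epsilon>}"

definition is_Lam :: "trm \<Rightarrow> bool" where
  "is_Lam M \<longleftrightarrow> (\<exists>P. M = Lam P)"

definition is_Mu :: "trm \<Rightarrow> bool" where
  "is_Mu M \<longleftrightarrow> (\<exists>P. M = Mu P)"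

lemma is_Lam_simps [simp]:
  "\<not> is_Lam (Var i)" "is_Lam (Lam M)" "\<not> is_Lam (App M N)" "\<not> is_Lam (Named a M)" "\<not> is_Lam (Mu M)"
  by (simp_all add: is_Lam_def)

lemma is_Mu_simps [simp]:
  "\<not> is_Mu (Var i)" "\<not> is_Mu (Lam M)" "\<not> is_Mu (App M N)" "\<not> is_Mu (Named a M)" "is_Mu (Mu M)"
  by (simp_all add: is_Mu_def)

inductive_simps contracts_simps:
  "contracts r (Var i) P"
  "contracts r (Lam M) P"
  "contracts r (App M N) P"
  "contracts r (Named a M) P"
  "contracts r (Mu M) P"

text \<open>For these five rules only the root constructors of the immediate subterms decide whether
  a term is a redex; \<theta> also inspects variables and is kept apart. Preserving normality thus
  reduces to preserving shapes.\<close>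

lemma redex_base_simps [simp]:
  "\<not> redex base_rules (Var i)"
  "\<not> redex base_rules (Lam M)"
  "redex base_rules (App M N) \<longleftrightarrow> is_Lam M \<or> is_Mu M \<or> is_Mu N"
  "redex base_rules (Named a M) \<longleftrightarrow> is_Mu M"
  "redex base_rules (Mu M) \<longleftrightarrow> is_Mu M"
  by (auto simp: redex_def is_Lam_def is_Mu_def contracts_simps)

lemma normal_simps:
  "normal R (Var i) \<longleftrightarrow> \<not> redex R (Var i)"
  "normal R (Lam M) \<longleftrightarrow> \<not> redex R (Lam M) \<and> normal R M"
  "normal R (App M N) \<longleftrightarrow> \<not> redex R (App M N) \<and> normal R M \<and> normal R N"
  "normal R (Named a M) \<longleftrightarrow> \<not> redex R (Named a M) \<and> normal R M"
  "normal R (Mu M) \<longleftrightarrow> \<not> redex R (Mu M) \<and> normal R M"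
  by (auto simp: normal_def)

lemma is_Lam_ren_mu [simp]: "is_Lam (ren_mu f M) \<longleftrightarrow> is_Lam M"
  by (cases M) simp_all

lemma is_Mu_ren_mu [simp]: "is_Mu (ren_mu f M) \<longleftrightarrow> is_Mu M"
  by (cases M) simp_all

lemma size_ren_mu [simp]: "size (ren_mu f M) = size M"
  by (induction M arbitrary: f) simp_all

text \<open>Renaming keeps every constructor, and no base rule compares \<mu>-variables, so
  \<open>f\<close> may be arbitrary, such as the non-injective renaming in
  \<open>drop_mu\<close>.\<close>

lemma normal_base_ren_mu [simp]: "normal base_rules (ren_mu f M) \<longleftrightarrow> normal base_rules M"
  by (induction M arbitrary: f) (simp_all add: normal_simps)

text \<open>A contraction deletes one \<open>Mu\<close> and one \<open>Named\<close>, and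
  \<open>drop_mu\<close> only renames.\<close>

lemma step_theta_size:
  assumes "step {\<theta>} M N"
  shows "size N < size M"
  using assms by induction (auto simp: contracts.simps drop_mu_def)

inductive_simps step_simps:
  "step R (Var i) P"
  "step R (Lam M) P"
  "step R (App M N) P"
  "step R (Named a M) P"

text \<open>A \<theta>-redex is rooted at \<open>Mu\<close>, so here the step takes place strictly
  below the root and keeps the root constructor.\<close>

lemma step_theta_shape:
  assumes "step {\<theta>} M N" "\<not> is_Mu M"
  shows "\<not> is_Mu N" "is_Lam N \<longleftrightarrow> is_Lam M"
  using assms by (cases M; auto simp: step_simps contracts_simps)+

text \<open>At the root, the contractum is a renamed subterm of a normal term. Below
  \<open>App\<close>, \<open>Named\<close> or \<open>Mu\<close>, normality excludes a
  \<open>Mu\<close> as immediate subterm, so \<open>step_theta_shape\<close> applies;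
  \<open>Lam\<close> puts no condition on its body.\<close>

lemma step_theta_normal_base:
  assumes "step {\<theta>} M N" "normal base_rules M"
  shows "normal base_rules N"
  using assms
  by induction (auto simp: contracts.simps normal_simps drop_mu_def step_theta_shape)

lemma step_mono:
  assumes "step R M N" "R \<subseteq> S"
  shows "step S M N"
  using assms by induction (auto intro: step.intros)

lemma not_normal_step:
  assumes "\<not> normal R M"
  shows "\<exists>N. step R M N"
  using assms by (induction M) (auto simp: normal_simps redex_def intro: step.intros)

lemma normal_Un: "normal (R \<union> S) M \<longleftrightarrow> normal R M \<and> normal S M"
  by (auto simp: normal_def redex_def)

lemma normal_base_theta_reduces:
  assumes "normal base_rules M"
  shows "\<exists>N. (step {\<theta>})\<^sup>*\<^sup>* M N \<and> normal (base_rules \<union> {\<theta>}) N"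
  using assms
proof (induction M rule: measure_induct_rule[of size])
  case (less M)
  show ?case
  proof (cases "normal {\<theta>} M")
    case True
    then show ?thesis
      using less.prems unfolding normal_Un by blast
  next
    case False
    then obtain M' where M': "step {\<theta>} M M'"
      using not_normal_step by blast
    \<comment> \<open>\<open>M'\<close> is smaller than \<open>M\<close> and still normal for the
      base rules, so the induction hypothesis applies.\<close>
    then obtain N where "(step {\<theta>})\<^sup>*\<^sup>* M' N" "normal (base_rules \<union> {\<theta>}) N"
      using less.IH[OF step_theta_size step_theta_normal_base] less.prems by blast
    then show ?thesis
      using M' by (blast intro: converse_rtranclp_into_rtranclp)
  qed
qed

theorem theorem5p3: "WN {\<beta>, \<mu>, \<mu>', \<rho>, \<epsilon>} \<subseteq> WN {\<beta>, \<mu>, \<mu>', \<rho>, \<epsilon>, \<theta>}"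
proof
  let ?S = "{\<beta>, \<mu>, \<mu>', \<rho>, \<epsilon>, \<theta>}"
  fix M
  assume "M \<in> WN base_rules"
  then obtain N where N: "(step base_rules)\<^sup>*\<^sup>* M N" "normal base_rules N"
    by (auto simp: WN_def)
  then obtain P where P: "(step {\<theta>})\<^sup>*\<^sup>* N P" "normal (base_rules \<union> {\<theta>}) P"
    using normal_base_theta_reduces by blast
  \<comment> \<open>Both phases, base steps first and \<theta>-steps after them, are also reductions
    for the full set of rules.\<close>
  have "(step ?S)\<^sup>*\<^sup>* M N"
    using N(1) by (rule rtranclp_mono[THEN predicate2D, rotated]) (auto intro: step_mono)
  also have "(step ?S)\<^sup>*\<^sup>* N P"
    using P(1) by (rule rtranclp_mono[THEN predicate2D, rotated]) (auto intro: step_mono)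
  finally have "(step ?S)\<^sup>*\<^sup>* M P" .
  moreover have "base_rules \<union> {\<theta>} = ?S"
    by auto
  ultimately show "M \<in> WN ?S"
    using P(2) by (auto simp: WN_def)
qed

end
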